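(* Let $A$ be a finite set of alternatives and let $\mathcal D\subseteq\mathcal L(A)$ be a maximal Condorcet domain. Then the following are equivalent: (i) $\mathcal D$ is a peak-pit Condorcet domain; (ii) $\mathcal D$ is directly connected; (iii) $\mathcal D$ is connected.
   Context: $\mathcal L(A)$ is the set of linear orders on the finite set $A$; a linear order is written as a word $x_1x_2\cdots x_n$ listing the alternatives from top (most preferred) to bottom. A domain is any subset $\mathcal D\subseteq\mathcal L(A)$. For $B\subseteq A$, $R_B$ denotes the restriction of $R$ to $B$ and $\mathcal D_B=\{R_B:R\in\mathcal D\}$. For distinct $a,b,c\in A$, $x\in\{a,b,c\}$ and $k\in\{1,2,3\}$, $\mathcal D_{\{a,b,c\}}$ satisfies the never-condition $xN_{\{a,b,c\}}k$ if no $x_1x_2x_3\in\mathcal D_{\{a,b,c\}}$ has $x_k=x$ ($k=1$: never-top, $k=2$: never-middle, $k=3$: never-bottom). $\mathcal D$ is a Condorcet domain if for every triple of distinct $a,b,c\in A$, $\mathcal D_{\{a,b,c\}}$ satisfies at least one never-condition; it is a peak-pit Condorcet domain if for every such triple $\mathcal D_{\{a,b,c\}}$ satisfies at least one never-top or never-bottom condition. A Condorcet domain $\mathcal D$ is maximal if no Condorcet domain $\mathcal D'\subseteq\mathcal L(A)$ strictly contains it. Two linear orders are alike if one is obtained from the other by swapping two alternatives in adjacent positions. A path of alike linear orders connecting $R$ and $T$ is a sequence $(R_1,\dots,R_k)$ with $R_1=R$, $R_k=T$ and $R_i,R_{i+1}$ alike for all $i$; a geodesic connecting $R$ and $T$ is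 such a path of minimum possible length $k$. $\mathcal D$ is connected if any two $R,T\in\mathcal D$ are connected by a path all of whose orders lie in $\mathcal D$, and directly connected if any two $R,T\in\mathcal D$ are connected by a geodesic all of whose orders lie in $\mathcal D$. *)

theory Defs
  imports Main "HOL-Combinatorics.Multiset_Permutations"
begin

text \<open>
  A linear order on a finite set \<open>A\<close> is represented by the word listing every element of \<open>A\<close>
  exactly once, from top (head of the list) to bottom. Thus \<open>permutations_of_set A\<close>
  is the set of all linear orders on \<open>A\<close>.
\<close>

abbreviation linear_orders :: "'a set \<Rightarrow> 'a list set" where
  "linear_orders A \<equiv> permutations_of_set A"

definition restrict_order :: "'a set \<Rightarrow> 'a list \<Rightarrow> 'a list" where
  "restrict_order B R = filter (\<lambda>x. x \<in> B) R"

definition restrict_domain :: "'a set \<Rightarrow> 'a list set \<Rightarrow> 'a list set" where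
  "restrict_domain B D = restrict_order B ` D"

text \<open>Positions are numbered \<open>1, 2, 3\<close> from the top, whereas list indices start at \<open>0\<close>.\<close>

definition never_condition :: "'a list set \<Rightarrow> 'a set \<Rightarrow> 'a \<Rightarrow> nat \<Rightarrow> bool" where
  "never_condition D B x k \<longleftrightarrow> \<not> (\<exists>w \<in> restrict_domain B D. w ! (k - 1) = x)"

definition condorcet_domain :: "'a set \<Rightarrow> 'a list set \<Rightarrow> bool" where
  "condorcet_domain A D \<longleftrightarrow> D \<subseteq> linear_orders A \<and>
     (\<forall>a\<in>A. \<forall>b\<in>A. \<forall>c\<in>A. a \<noteq> b \<and> a \<noteq> c \<and> b \<noteq> c \<longrightarrow>
        (\<exists>x\<in>{a, b, c}. \<exists>k\<in>{1, 2, 3}. never_condition D {a, b, c} x k))"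

definition peak_pit_domain :: "'a set \<Rightarrow> 'a list set \<Rightarrow> bool" where
  "peak_pit_domain A D \<longleftrightarrow> condorcet_domain A D \<and>
     (\<forall>a\<in>A. \<forall>b\<in>A. \<forall>c\<in>A. a \<noteq> b \<and> a \<noteq> c \<and> b \<noteq> c \<longrightarrow>
        (\<exists>x\<in>{a, b, c}. \<exists>k\<in>{1, 3}. never_condition D {a, b, c} x k))"

definition maximal_condorcet_domain :: "'a set \<Rightarrow> 'a list set \<Rightarrow> bool" where
  "maximal_condorcet_domain A D \<longleftrightarrow>
     condorcet_domain A D \<and> \<not> (\<exists>D'. condorcet_domain A D' \<and> D \<subset> D')"

definition alike :: "'a list \<Rightarrow> 'a list \<Rightarrow> bool" where
  "alike R T \<longleftrightarrow> (\<exists>us x y vs. x \<noteq> y \<and> R = us @ [x, y] @ vs \<and> T = us @ [y, x] @ vs)"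

definition alike_path :: "'a set \<Rightarrow> 'a list \<Rightarrow> 'a list \<Rightarrow> 'a list list \<Rightarrow> bool" where
  "alike_path A R T p \<longleftrightarrow> p \<noteq> [] \<and> set p \<subseteq> linear_orders A \<and> hd p = R \<and> last p = T \<and>
     successively alike p"

text \<open>The minimum ranges over all paths in \<open>linear_orders A\<close>, not only those inside a given domain.\<close>

definition geodesic :: "'a set \<Rightarrow> 'a list \<Rightarrow> 'a list \<Rightarrow> 'a list list \<Rightarrow> bool" where
  "geodesic A R T p \<longleftrightarrow> alike_path A R T p \<and> (\<forall>q. alike_path A R T q \<longrightarrow> length p \<le> length q)"

definition connected_domain :: "'a set \<Rightarrow> 'a list set \<Rightarrow> bool" where
  "connected_domain A D \<longleftrightarrow> (\<forall>R\<in>D. \<forall>T\<in>D. \<exists>p. alike_path A R T p \<and> set p \<subseteq> D)"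

definition directly_connected_domain :: "'a set \<Rightarrow> 'a list set \<Rightarrow> bool" where
  "directly_connected_domain A D \<longleftrightarrow> (\<forall>R\<in>D. \<forall>T\<in>D. \<exists>p. geodesic A R T p \<and> set p \<subseteq> D)"

end

theory Submission
  imports Defs
begin

text \<open>
  If \<open>x\<close> is never in the middle of a triple but occurs at its top and at its bottom, then some step
  of an alike path inside the domain moves \<open>x\<close> past two alternatives at once, which no swap of
  neighbours does; so connected Condorcet domains are peak-pit.

  Conversely, a peak-pit domain has no Condorcet cycles, and the majority order of three of its
  members has on each triple only tops and bottoms that are already attained; by maximality it
  belongs to the domain. Given members \<open>R \<noteq> T\<close>, choose \<open>Q \<noteq> R\<close> strictly between them if there is one,
  and induct. Otherwise the majority of \<open>R\<close>, \<open>T\<close> and any member \<open>Q\<close> is \<open>R\<close> or agrees with \<open>T\<close> wherever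
  \<open>T\<close> disagrees with \<open>R\<close>, so \<open>Q\<close> sides wholly with \<open>R\<close> or wholly with \<open>T\<close> on these pairs. Swapping any
  neighbours in \<open>R\<close> that \<open>T\<close> inverts then keeps every triple peak-pit, so the result is again a member.
  Iterating yields a path whose number of steps is the number of inversions between \<open>R\<close> and \<open>T\<close>,
  hence a geodesic.
\<close>

section \<open>Precedence in a word\<close>

text \<open>Recursion over the word, rather than comparison of indices, makes appends, filters and
  adjacent swaps a matter of simplification.\<close>

fun prec :: "'a list \<Rightarrow> 'a \<Rightarrow> 'a \<Rightarrow> bool" where
  "prec [] x y \<longleftrightarrow> False"
| "prec (r # R) x y \<longleftrightarrow> r = x \<and> y \<in> set R \<or> prec R x y"

lemma prec_append:
  "prec (us @ vs) x y \<longleftrightarrow> prec us x y \<or> prec vs x y \<or> x \<in> set us \<and> y \<in> set vs"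
  by (induction us) auto

lemma prec_in_set: "prec R x y \<Longrightarrow> x \<in> set R \<and> y \<in> set R"
  by (induction R) auto

lemma prec_filter: "prec (filter P R) x y \<longleftrightarrow> P x \<and> P y \<and> prec R x y"
  by (induction R) (auto dest: prec_in_set)

lemma prec_asym: "distinct R \<Longrightarrow> prec R x y \<Longrightarrow> \<not> prec R y x"
  by (induction R) (auto dest: prec_in_set)

lemma prec_irrefl: "distinct R \<Longrightarrow> \<not> prec R x x"
  using prec_asym by fast

lemma prec_total: "x \<in> set R \<Longrightarrow> y \<in> set R \<Longrightarrow> x \<noteq> y \<Longrightarrow> prec R x y \<or> prec R y x"
  by (induction R) auto

lemma prec_trans: "distinct R \<Longrightarrow> prec R x y \<Longrightarrow> prec R y z \<Longrightarrow> prec R x z"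
  by (induction R) (auto dest: prec_in_set)

lemma linear_orders_iff: "R \<in> linear_orders A \<longleftrightarrow> set R = A \<and> distinct R"
  by (auto simp: permutations_of_set_def)

lemma prec_flip:
  assumes "R \<in> linear_orders A" "x \<in> A" "y \<in> A" "x \<noteq> y"
  shows "prec R y x \<longleftrightarrow> \<not> prec R x y"
  using assms prec_total[of x R y] prec_asym[of R x y] by (auto simp: linear_orders_iff)

lemma sorted_wrt_prec: "distinct R \<Longrightarrow> sorted_wrt (prec R) R"
  by (induction R) (auto intro: sorted_wrt_mono_rel[rotated])

text \<open>Different heads would each occur in the other word's tail, against asymmetry. Asymmetry
  also excludes repetitions, so the tails have equal sets.\<close>

lemma sorted_wrt_unique:
  assumes "\<And>x y. r x y \<Longrightarrow> \<not> r y x"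
  shows "sorted_wrt r R \<Longrightarrow> sorted_wrt r T \<Longrightarrow> set R = set T \<Longrightarrow> R = T"
proof (induction R arbitrary: T)
  case Nil
  then show ?case by simp
next
  case (Cons x R)
  obtain y T' where T: "T = y # T'"
    using Cons.prems by (cases T) auto
  have "x = y"
    using Cons.prems T assms by (metis insertE list.set_intros(1) list.simps(15) sorted_wrt.simps(2))
  moreover have "x \<notin> set R" "y \<notin> set T'"
    using Cons.prems T assms by (metis sorted_wrt.simps(2))+
  ultimately have "set R = set T'"
    using Cons.prems(3) T by (simp add: insert_ident)
  then show ?case
    using Cons T \<open>x = y\<close> by simp
qed

text \<open>Insertion: a new element goes between those \<open>r\<close> puts above it and those
  \<open>r\<close> puts below it, both kept in their old order. Transitivity through it shows that
  the result follows \<open>r\<close>.\<close>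

lemma ex_linear_order_of_relation:
  assumes "finite A"
    and "\<And>x y. x \<in> A \<Longrightarrow> y \<in> A \<Longrightarrow> x \<noteq> y \<Longrightarrow> r y x \<longleftrightarrow> \<not> r x y"
    and "\<And>x. x \<in> A \<Longrightarrow> \<not> r x x"
    and "\<And>x y z. x \<in> A \<Longrightarrow> y \<in> A \<Longrightarrow> z \<in> A \<Longrightarrow> r x y \<Longrightarrow> r y z \<Longrightarrow> r x z"
  shows "\<exists>R\<in>linear_orders A. \<forall>x\<in>A. \<forall>y\<in>A. prec R x y \<longleftrightarrow> r x y"
  using assms
proof (induction A rule: finite_induct)
  case empty
  show ?case by simp
next
  case (insert a A)
  have "\<exists>R\<in>linear_orders A. \<forall>x\<in>A. \<forall>y\<in>A. prec R x y \<longleftrightarrow> r x y"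
  proof (rule insert.IH)
    show "r y x \<longleftrightarrow> \<not> r x y" if "x \<in> A" "y \<in> A" "x \<noteq> y" for x y
      by (rule insert.prems(1)) (use that in simp_all)
    show "\<not> r x x" if "x \<in> A" for x
      by (rule insert.prems(2)) (use that in simp)
    show "r x z" if "x \<in> A" "y \<in> A" "z \<in> A" "r x y" "r y z" for x y z
      by (rule insert.prems(3)[of x y z]) (use that in simp_all)
  qed
  then obtain R where R: "set R = A" "distinct R" "\<forall>x\<in>A. \<forall>y\<in>A. prec R x y \<longleftrightarrow> r x y"
    by (auto simp: linear_orders_iff)
  let ?R = "filter (\<lambda>x. r x a) R @ a # filter (\<lambda>x. r a x) R"
  have flip: "r x a \<longleftrightarrow> \<not> r a x" if "x \<in> A" for x
    by (rule insert.prems(1)) (use insert.hyps that in auto)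
  have "?R \<in> linear_orders (insert a A)"
    using R insert.hyps by (auto simp: linear_orders_iff flip)
  moreover have "prec ?R x y \<longleftrightarrow> r x y" if xy: "x \<in> insert a A" "y \<in> insert a A" for x y
  proof -
    have tr: "r x y \<Longrightarrow> r y a \<Longrightarrow> r x a" "r a x \<Longrightarrow> r x y \<Longrightarrow> r a y" "r x a \<Longrightarrow> r a y \<Longrightarrow> r x y"
      using insert.prems(3)[of x y a] insert.prems(3)[of a x y] insert.prems(3)[of x a y] xy
      by blast+
    have irr: "\<not> r a a"
      using insert.prems(2) by blast
    have mem: "z \<in> set (filter P R) \<longleftrightarrow> z \<in> A \<and> P z" for z P
      using R(1) by auto
    have out: "\<not> prec R a z" "\<not> prec R z a" for z
      using R(1) insert.hyps prec_in_set by metis+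
    have prec_R: "prec ?R x y \<longleftrightarrow> prec R x y \<and> (r x a \<and> r y a \<or> r a x \<and> r a y)
        \<or> r x a \<and> x \<in> A \<and> (y = a \<or> r a y \<and> y \<in> A) \<or> x = a \<and> r a y \<and> y \<in> A"
      by (auto simp: prec_append prec_filter mem simp del: set_filter)
    consider "x \<in> A" "y \<in> A" | "x = a" | "y = a" "x \<in> A"
      using xy by blast
    then show ?thesis
    proof cases
      case 1
      have "x \<noteq> a" "y \<noteq> a"
        using 1 insert.hyps by auto
      then show ?thesis
        unfolding prec_R using 1 R(3) tr flip[OF 1(1)] flip[OF 1(2)] by blast
    next
      case 2
      then have "\<not> prec R x y" "x \<notin> A"
        using out insert.hyps by auto
      then show ?thesis
        unfolding prec_R using 2 irr xy by blast
    next
      case 3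
      then have "\<not> prec R x y" "y \<notin> A" "x \<noteq> a"
        using out insert.hyps by auto
      then show ?thesis
        unfolding prec_R using 3 irr by blast
    qed
  qed
  ultimately show ?case
    by blast
qed

section \<open>Never-conditions in terms of precedence\<close>

definition top_in :: "'a set \<Rightarrow> 'a \<Rightarrow> 'a list \<Rightarrow> bool" where
  "top_in B x R \<longleftrightarrow> (\<forall>y\<in>B - {x}. prec R x y)"

definition bot_in :: "'a set \<Rightarrow> 'a \<Rightarrow> 'a list \<Rightarrow> bool" where
  "bot_in B x R \<longleftrightarrow> (\<forall>y\<in>B - {x}. prec R y x)"

definition peak_pit_on :: "'a set \<Rightarrow> 'a list set \<Rightarrow> bool" where
  "peak_pit_on B D \<longleftrightarrow> (\<exists>x\<in>B. (\<forall>R\<in>D. \<not> top_in B x R) \<or> (\<forall>R\<in>D. \<not> bot_in B x R))"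

lemma restrict_triple_cases:
  assumes "R \<in> linear_orders A" "{a, b, c} \<subseteq> A" "distinct [a, b, c]" "x \<in> {a, b, c}"
  defines "w \<equiv> restrict_order {a, b, c} R"
  shows "w ! 0 = x \<longleftrightarrow> top_in {a, b, c} x R"
    and "w ! 2 = x \<longleftrightarrow> bot_in {a, b, c} x R"
    and "w ! 1 = x \<longleftrightarrow> \<not> top_in {a, b, c} x R \<and> \<not> bot_in {a, b, c} x R"
proof -
  have w: "set w = {a, b, c}" "distinct w"
    using assms by (auto simp: w_def restrict_order_def linear_orders_iff)
  then have "length w = 3"
    using assms(3) distinct_card[of w] by simp
  then obtain u v t where uvt: "w = [u, v, t]"
    by (auto simp: numeral_3_eq_3 length_Suc_conv)
  have p: "y \<in> {a, b, c} \<Longrightarrow> z \<in> {a, b, c} \<Longrightarrow> prec R y z \<longleftrightarrow> prec w y z" for y z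
    by (auto simp: w_def restrict_order_def prec_filter)
  have tb: "top_in {a, b, c} x R \<longleftrightarrow> (\<forall>y\<in>set w - {x}. prec w x y)"
    "bot_in {a, b, c} x R \<longleftrightarrow> (\<forall>y\<in>set w - {x}. prec w y x)"
    using p assms(4) w unfolding top_in_def bot_in_def by blast+
  have "x \<in> set w"
    using assms(4) w by simp
  then show "w ! 0 = x \<longleftrightarrow> top_in {a, b, c} x R"
    and "w ! 2 = x \<longleftrightarrow> bot_in {a, b, c} x R"
    and "w ! 1 = x \<longleftrightarrow> \<not> top_in {a, b, c} x R \<and> \<not> bot_in {a, b, c} x R"
    unfolding tb uvt using w(2) uvt by auto
qed

text \<open>Positions 1, 2, 3 are indices 0, 1, 2 of the restricted word. From here on only
  comparisons in the unrestricted orders are needed.\<close>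

lemma never_condition_triple:
  assumes "D \<subseteq> linear_orders A" "{a, b, c} \<subseteq> A" "distinct [a, b, c]" "x \<in> {a, b, c}"
  shows "never_condition D {a, b, c} x 1 \<longleftrightarrow> (\<forall>R\<in>D. \<not> top_in {a, b, c} x R)"
    and "never_condition D {a, b, c} x 3 \<longleftrightarrow> (\<forall>R\<in>D. \<not> bot_in {a, b, c} x R)"
    and "never_condition D {a, b, c} x 2 \<longleftrightarrow> (\<forall>R\<in>D. top_in {a, b, c} x R \<or> bot_in {a, b, c} x R)"
proof -
  have R: "R \<in> linear_orders A" if "R \<in> D" for R
    using that assms by blast
  note cs = restrict_triple_cases[OF R assms(2-4)]
  show "never_condition D {a, b, c} x 1 \<longleftrightarrow> (\<forall>R\<in>D. \<not> top_in {a, b, c} x R)"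
    "never_condition D {a, b, c} x 3 \<longleftrightarrow> (\<forall>R\<in>D. \<not> bot_in {a, b, c} x R)"
    "never_condition D {a, b, c} x 2 \<longleftrightarrow> (\<forall>R\<in>D. top_in {a, b, c} x R \<or> bot_in {a, b, c} x R)"
    unfolding never_condition_def restrict_domain_def using cs by simp_all
qed

lemma peak_pit_domain_iff:
  "peak_pit_domain A D \<longleftrightarrow> D \<subseteq> linear_orders A \<and>
     (\<forall>a b c. {a, b, c} \<subseteq> A \<longrightarrow> distinct [a, b, c] \<longrightarrow> peak_pit_on {a, b, c} D)"
proof -
  have *: "peak_pit_on {a, b, c} D \<longleftrightarrow> (\<exists>x\<in>{a, b, c}. \<exists>k\<in>{1, 3}. never_condition D {a, b, c} x k)"
    if "D \<subseteq> linear_orders A" "{a, b, c} \<subseteq> A" "distinct [a, b, c]" for a b c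
    unfolding peak_pit_on_def using never_condition_triple(1,2)[OF that] by simp
  show ?thesis
    unfolding peak_pit_domain_def condorcet_domain_def using * by (auto; blast)
qed

section \<open>Connected domains are peak-pit\<close>

text \<open>\<open>(p, q)\<close> is the swapped pair. This serves twice: no alternative passes two
  others in one step, and one step removes at most one inversion.\<close>

lemma alike_prec:
  assumes "alike R T" "distinct R"
  obtains p q where "prec R p q" "\<And>x y. (x, y) \<noteq> (p, q) \<Longrightarrow> prec R x y \<Longrightarrow> prec T x y"
proof -
  obtain us p q vs where "R = us @ [p, q] @ vs" "T = us @ [q, p] @ vs"
    using assms unfolding alike_def by blast
  then show thesis
    using assms(2) by (intro that[of p q]) (auto simp: prec_append)
qed

lemma connected_imp_peak_pit:
  assumes cd: "condorcet_domain A D" and conn: "connected_domain A D"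
  shows "peak_pit_domain A D"
  unfolding peak_pit_domain_iff
proof (intro conjI allI impI)
  show sub: "D \<subseteq> linear_orders A"
    using cd by (simp add: condorcet_domain_def)
  fix a b c
  assume B: "{a, b, c} \<subseteq> A" "distinct [a, b, c]"
  let ?B = "{a, b, c}"
  have ne: "a \<noteq> b \<and> a \<noteq> c \<and> b \<noteq> c" "a \<in> A" "b \<in> A" "c \<in> A"
    using B by auto
  obtain x k where x: "x \<in> ?B" "k \<in> {1, 2, 3}" "never_condition D ?B x k"
    using cd ne unfolding condorcet_domain_def by blast
  note nc = never_condition_triple[OF sub B x(1)]
  show "peak_pit_on ?B D"
  proof (rule ccontr)
    \<comment> \<open>Every alternative of the triple is now top somewhere and bottom somewhere, so
      the never-condition on \<open>x\<close> can only be never-middle.\<close>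
    assume no: "\<not> peak_pit_on ?B D"
    then obtain R T where RT: "R \<in> D" "top_in ?B x R" "T \<in> D" "bot_in ?B x T"
      using x(1) unfolding peak_pit_on_def by blast
    then have mid: "\<forall>R\<in>D. top_in ?B x R \<or> bot_in ?B x R"
      using x nc by auto
    obtain p where p: "p \<noteq> []" "hd p = R" "last p = T" "successively alike p" "set p \<subseteq> D"
      using conn RT unfolding connected_domain_def alike_path_def by blast
    have "card (?B - {x}) = 2"
      using x(1) B by auto
    then obtain y z where yz: "?B - {x} = {y, z}" "y \<noteq> z"
      by (auto simp: card_2_iff)
    \<comment> \<open>Falling from top to bottom would reverse \<open>x\<close> with both
      \<open>y\<close> and \<open>z\<close> in a single swap.\<close>
    have step: "top_in ?B x S'" if S: "S \<in> D" "S' \<in> D" "alike S S'" "top_in ?B x S" for S S'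
    proof (rule ccontr)
      assume "\<not> top_in ?B x S'"
      then have "bot_in ?B x S'"
        using mid S by blast
      then have S': "prec S' y x" "prec S' z x"
        using yz by (auto simp: bot_in_def)
      have "distinct S" "distinct S'"
        using S sub by (auto simp: linear_orders_iff)
      then have "\<not> prec S' x y" "\<not> prec S' x z" 
        using S' prec_asym by metis+
      moreover have "prec S x y" "prec S x z"
        using yz S by (auto simp: top_in_def)
      ultimately show False
        using alike_prec[OF \<open>alike S S'\<close> \<open>distinct S\<close>] yz(2) by (metis prod.inject)
    qed
    \<comment> \<open>Carried along the path, \<open>x\<close> is still top in \<open>T\<close>,
      where it is also bottom.\<close>
    have "top_in ?B x (last p)"
      using p(1,4,5) RT(2)[folded p(2)]
    proof (induction p)
      case (Cons S p)
      then show ?case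
        using step by (cases p) auto
    qed simp
    then have "prec T x y" "prec T y x"
      using p RT yz by (auto simp: top_in_def bot_in_def)
    then show False
      using prec_asym RT sub by (metis linear_orders_iff subsetD)
  qed
qed

section \<open>Maximal peak-pit domains are closed under majority of three\<close>

text \<open>Both majority orders and swapped neighbours enter \<open>D\<close> this way: the
  enlarged domain is still Condorcet, so maximality leaves no room for a new order.\<close>

lemma maximal_memI:
  assumes "maximal_condorcet_domain A D" "peak_pit_domain A D" "S \<in> linear_orders A"
    and "\<And>a b c. {a, b, c} \<subseteq> A \<Longrightarrow> distinct [a, b, c] \<Longrightarrow> peak_pit_on {a, b, c} (insert S D)"
  shows "S \<in> D"
proof -
  have "peak_pit_domain A (insert S D)"
    using assms by (simp add: peak_pit_domain_iff)
  then have "condorcet_domain A (insert S D)"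
    by (simp add: peak_pit_domain_def)
  then show ?thesis
    using assms(1) by (auto simp: maximal_condorcet_domain_def)
qed

text \<open>The never-condition that holds in \<open>D\<close> survives, since \<open>S\<close>
  brings no new top or bottom.\<close>

lemma peak_pit_on_insert:
  assumes "peak_pit_on B D"
    and "\<And>x. x \<in> B \<Longrightarrow> top_in B x S \<Longrightarrow> \<exists>R\<in>D. top_in B x R"
    and "\<And>x. x \<in> B \<Longrightarrow> bot_in B x S \<Longrightarrow> \<exists>R\<in>D. bot_in B x R"
  shows "peak_pit_on B (insert S D)"
  using assms unfolding peak_pit_on_def by blast

definition majority :: "'a list \<Rightarrow> 'a list \<Rightarrow> 'a list \<Rightarrow> 'a \<Rightarrow> 'a \<Rightarrow> bool" where
  "majority R T Q x y \<longleftrightarrow>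
     prec R x y \<and> prec T x y \<or> prec R x y \<and> prec Q x y \<or> prec T x y \<and> prec Q x y"

lemma ex_majority:
  assumes fin: "finite A" and mx: "maximal_condorcet_domain A D" and pp: "peak_pit_domain A D"
    and D: "R \<in> D" "T \<in> D" "Q \<in> D"
  shows "\<exists>M\<in>D. \<forall>x\<in>A. \<forall>y\<in>A. prec M x y \<longleftrightarrow> majority R T Q x y"
proof -
  have sub: "D \<subseteq> linear_orders A"
    using pp by (simp add: peak_pit_domain_iff)
  have flip: "prec S y x \<longleftrightarrow> \<not> prec S x y" if "S \<in> D" "x \<in> A" "y \<in> A" "x \<noteq> y" for S x y
    by (rule prec_flip[of S A]) (use that sub in auto)
  have irr: "\<not> prec S x x" if "S \<in> D" for S x
    using that sub prec_irrefl by (metis linear_orders_iff subsetD)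
  let ?r = "majority R T Q"
  have r_flip: "?r y x \<longleftrightarrow> \<not> ?r x y" if "x \<in> A" "y \<in> A" "x \<noteq> y" for x y
    using flip[OF _ that] D unfolding majority_def by blast
  have r_irr: "\<not> ?r x x" for x
    using irr D unfolding majority_def by blast
  \<comment> \<open>Two majorities among three voters share a voter.\<close>
  have pair: "\<exists>S\<in>D. prec S x y \<and> prec S u v" if "?r x y" "?r u v" for x y u v
    using that D unfolding majority_def by (elim disjE conjE) blast+
  have r_trans: "?r x z" if xyz: "x \<in> A" "y \<in> A" "z \<in> A" "?r x y" "?r y z" for x y z
  proof (rule ccontr)
    assume no: "\<not> ?r x z"
    have ne: "x \<noteq> y" "y \<noteq> z" "x \<noteq> z"
    proof -
      show "x \<noteq> y" "y \<noteq> z"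
        using xyz(4,5) r_irr by auto
      show "x \<noteq> z"
        using xyz(5) r_flip[of x y] xyz(1,2,4) \<open>x \<noteq> y\<close> by auto
    qed
    then have zx: "?r z x"
      using r_flip[of x z] xyz(1,3) no by simp
    \<comment> \<open>The shared voters order the cycle as \<open>x y z\<close>,
      \<open>y z x\<close> and \<open>z x y\<close>: each alternative is top once and bottom
      once.\<close>
    obtain S1 where S1: "S1 \<in> D" "prec S1 x y" "prec S1 y z"
      using pair[OF xyz(4,5)] by blast
    obtain S2 where S2: "S2 \<in> D" "prec S2 y z" "prec S2 z x"
      using pair[OF xyz(5) zx] by blast
    obtain S3 where S3: "S3 \<in> D" "prec S3 z x" "prec S3 x y"
      using pair[OF zx xyz(4)] by blast
    note S = S1(1) S2(1) S3(1) S1(2,3) S2(2,3) S3(2,3)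
    have "distinct S1" "distinct S2" "distinct S3"
      using S(1-3) sub by (auto simp: linear_orders_iff)
    then have "prec S1 x z" "prec S2 y x" "prec S3 z y"
      using prec_trans[of S1 x y z] prec_trans[of S2 y z x] prec_trans[of S3 z x y] S by blast+
    then have "top_in {x, y, z} x S1" "bot_in {x, y, z} z S1" "top_in {x, y, z} y S2"
      "bot_in {x, y, z} x S2" "top_in {x, y, z} z S3" "bot_in {x, y, z} y S3"
      using S by (auto simp: top_in_def bot_in_def)
    then have "\<not> peak_pit_on {x, y, z} D"
      using S unfolding peak_pit_on_def by blast
    then show False
      using pp xyz ne by (simp add: peak_pit_domain_iff)
  qed
  obtain M where M: "M \<in> linear_orders A" "\<forall>x\<in>A. \<forall>y\<in>A. prec M x y \<longleftrightarrow> ?r x y"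
  proof -
    have "\<exists>M\<in>linear_orders A. \<forall>x\<in>A. \<forall>y\<in>A. prec M x y \<longleftrightarrow> ?r x y"
      by (rule ex_linear_order_of_relation[OF fin r_flip r_irr r_trans])
    then show thesis
      using that by blast
  qed
  have "M \<in> D"
  proof (rule maximal_memI[OF mx pp M(1)])
    fix a b c
    assume B: "{a, b, c} \<subseteq> A" "distinct [a, b, c]"
    let ?B = "{a, b, c}"
    show "peak_pit_on ?B (insert M D)"
    proof (rule peak_pit_on_insert)
      show "peak_pit_on ?B D"
        using pp B by (simp add: peak_pit_domain_iff)
      fix x assume x: "x \<in> ?B"
      have "card (?B - {x}) = 2"
        using x B by auto
      then obtain y z where yz: "?B - {x} = {y, z}"
        by (auto simp: card_2_iff)
      have inA: "x \<in> A" "y \<in> A" "z \<in> A"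
        using x yz B by blast+
      \<comment> \<open>Being top or bottom of a triple is two comparisons, and one voter shares
        both with \<open>M\<close>.\<close>
      show "\<exists>R\<in>D. top_in ?B x R" if "top_in ?B x M"
        using that pair[of x y x z] M(2) inA unfolding top_in_def yz by simp
      show "\<exists>R\<in>D. bot_in ?B x R" if "bot_in ?B x M"
        using that pair[of y x z x] M(2) inA unfolding bot_in_def yz by simp
    qed
  qed
  then show ?thesis
    using M by blast
qed

section \<open>One step towards a target\<close>

text \<open>The inversions, each recorded once in the orientation of \<open>R\<close>; for linear
  orders on the same set their number is the Kendall tau distance.\<close>

definition Dis :: "'a list \<Rightarrow> 'a list \<Rightarrow> ('a \<times> 'a) set" where
  "Dis R T = {(x, y). prec R x y \<and> prec T y x}"

lemma finite_Dis: "finite (Dis R T)"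
  by (rule finite_subset[of _ "set R \<times> set R"]) (auto simp: Dis_def dest: prec_in_set)

lemma Dis_self: "distinct R \<Longrightarrow> Dis R R = {}"
  using prec_asym by (fastforce simp: Dis_def)

text \<open>If all neighbours in \<open>R\<close> agreed with \<open>T\<close>, transitivity would
  sort \<open>R\<close> by \<open>prec T\<close>, and \<open>T\<close> is the only such
  word.\<close>

lemma ex_adjacent_disagreement:
  assumes "R \<in> linear_orders A" "T \<in> linear_orders A" "R \<noteq> T"
  obtains us p q vs where "R = us @ [p, q] @ vs" "prec T q p"
proof -
  have "\<not> successively (prec T) R"
  proof
    assume "successively (prec T) R"
    moreover have "transp (prec T)"
      using assms(2) by (auto intro!: transpI intro: prec_trans simp: linear_orders_iff)
    ultimately have "sorted_wrt (prec T) R"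
      by (simp add: successively_conv_sorted_wrt)
    moreover have "sorted_wrt (prec T) T"
      using assms sorted_wrt_prec by (auto simp: linear_orders_iff)
    moreover have "\<And>x y. prec T x y \<Longrightarrow> \<not> prec T y x"
      using assms(2) prec_asym[of T] by (simp add: linear_orders_iff)
    ultimately show False
      using assms sorted_wrt_unique[of "prec T" R T] by (auto simp: linear_orders_iff)
  qed
  then obtain i where i: "Suc i < length R" "\<not> prec T (R ! i) (R ! Suc i)"
    by (auto simp: successively_conv_nth)
  have "R = take i R @ [R ! i, R ! Suc i] @ drop (Suc (Suc i)) R"
    using i(1) by (metis Cons_nth_drop_Suc Suc_lessD append_Cons append_Nil append_take_drop_id)
  moreover have "prec T (R ! Suc i) (R ! i)"
  proof -
    have "R ! i \<noteq> R ! Suc i"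
      using i(1) assms(1) by (simp add: linear_orders_iff nth_eq_iff_index_eq)
    moreover have "R ! i \<in> A" "R ! Suc i \<in> A"
      using i(1) assms(1) nth_mem[of i R] nth_mem[of "Suc i" R] by (auto simp: linear_orders_iff)
    ultimately show ?thesis
      using i(2) prec_flip[OF assms(2)] by blast
  qed
  ultimately show thesis
    by (rule that)
qed

lemma ex_step:
  assumes fin: "finite A" and mx: "maximal_condorcet_domain A D" and pp: "peak_pit_domain A D"
    and R: "R \<in> D"
  shows "T \<in> D \<Longrightarrow> R \<noteq> T \<Longrightarrow>
    \<exists>us p q vs. R = us @ [p, q] @ vs \<and> us @ [q, p] @ vs \<in> D \<and> prec T q p"
proof (induction "card (Dis R T)" arbitrary: T rule: less_induct)
  case less
  have sub: "D \<subseteq> linear_orders A"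
    using pp by (simp add: peak_pit_domain_iff)
  show ?case
  proof (cases "\<exists>Q\<in>D. Q \<noteq> R \<and> Dis R Q \<subset> Dis R T")
    case True
    then obtain Q where Q: "Q \<in> D" "Q \<noteq> R" "Dis R Q \<subset> Dis R T"
      by blast
    \<comment> \<open>A swap towards \<open>Q\<close> is also a swap towards \<open>T\<close>,
      because \<open>Dis R Q\<close> lies in \<open>Dis R T\<close>.\<close>
    then obtain us p q vs where s: "R = us @ [p, q] @ vs" "us @ [q, p] @ vs \<in> D" "prec Q q p"
      using less.hyps[of Q] psubset_card_mono[OF finite_Dis Q(3)] by blast
    then have "(p, q) \<in> Dis R Q"
      by (auto simp: Dis_def prec_append)
    then show ?thesis
      using s Q(3) by (auto simp: Dis_def)
  next
    case False
    \<comment> \<open>With no member strictly between, any neighbours of \<open>R\<close> inverted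
      by \<open>T\<close> will do.\<close>
    obtain us p q vs where s: "R = us @ [p, q] @ vs" "prec T q p"
      using ex_adjacent_disagreement less.prems R sub by (metis subsetD)
    let ?S = "us @ [q, p] @ vs"
    have lin: "S \<in> linear_orders A" if "S \<in> D" for S
      using that sub by blast
    have flip: "prec S y x \<longleftrightarrow> \<not> prec S x y" if "S \<in> D" "x \<in> A" "y \<in> A" "x \<noteq> y" for S x y
      by (rule prec_flip[of S A]) (use that sub in auto)
    have S: "?S \<in> linear_orders A"
      using lin[OF R] s(1) by (auto simp: linear_orders_iff)
    have pq: "p \<in> A" "q \<in> A" "p \<noteq> q" "prec R p q"
      using lin[OF R] s(1) by (auto simp: linear_orders_iff prec_append)
    have S_prec: "prec ?S x y \<longleftrightarrow> prec R x y" if "(x, y) \<noteq> (p, q)" "(x, y) \<noteq> (q, p)" for x y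
      using that unfolding s(1) by (auto simp: prec_append)
    have S_qp: "prec ?S q p" "\<not> prec ?S p q"
      using prec_flip[OF S pq(2,1)] pq(3) by (auto simp: prec_append)
    text \<open>The majority of \<open>R\<close>, \<open>T\<close> and \<open>Q\<close> lies between \<open>R\<close> and \<open>T\<close>, so it is \<open>R\<close> or
      disagrees with \<open>R\<close> on as much as \<open>T\<close> does.\<close>
    have dich: "Dis R T \<subseteq> Dis R Q \<or> Dis R T \<inter> Dis R Q = {}" if Q: "Q \<in> D" for Q
    proof -
      obtain M where M: "M \<in> D" "\<forall>x\<in>A. \<forall>y\<in>A. prec M x y \<longleftrightarrow> majority R T Q x y"
        using ex_majority[OF fin mx pp R less.prems(1) Q] by blast
      \<comment> \<open>The majority reverses a pair of \<open>R\<close> exactly when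
        \<open>T\<close> and \<open>Q\<close> both do.\<close>
      have "Dis R M = Dis R T \<inter> Dis R Q"
      proof -
        have "(x, y) \<in> Dis R M \<longleftrightarrow> (x, y) \<in> Dis R T \<inter> Dis R Q" for x y
        proof (cases "prec R x y")
          case True
          then have "x \<in> A" "y \<in> A" "\<not> prec R y x"
            using lin[OF R] prec_in_set[OF True] prec_asym[OF _ True] by (auto simp: linear_orders_iff)
          then show ?thesis
            using M(2) True by (auto simp: Dis_def majority_def)
        qed (simp add: Dis_def)
        then show ?thesis by auto
      qed
      moreover have "M = R \<or> \<not> Dis R M \<subset> Dis R T"
        using False M(1) by blast
      ultimately show ?thesis
        using Dis_self[of R] lin[OF R] by (auto simp: linear_orders_iff)
    qed
    have "?S \<in> D"
    proof (rule maximal_memI[OF mx pp S])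
      fix a b c
      assume B: "{a, b, c} \<subseteq> A" "distinct [a, b, c]"
      let ?B = "{a, b, c}"
      have ppB: "peak_pit_on ?B D"
        using pp B by (simp add: peak_pit_domain_iff)
      show "peak_pit_on ?B (insert ?S D)"
      proof (cases "p \<in> ?B \<and> q \<in> ?B")
        case False
        have "prec ?S x y \<longleftrightarrow> prec R x y" if "x \<in> ?B" "y \<in> ?B" for x y
          by (rule S_prec) (use that False in auto)
        then have "top_in ?B x ?S \<longleftrightarrow> top_in ?B x R" "bot_in ?B x ?S \<longleftrightarrow> bot_in ?B x R"
          if "x \<in> ?B" for x
          using that by (simp_all add: top_in_def bot_in_def)
        then show ?thesis
          using R by (intro peak_pit_on_insert[OF ppB]) blast+
      next
        case True
        then obtain e where e: "?B = {p, q, e}" "e \<noteq> p" "e \<noteq> q"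
          using B pq(3) by auto
        have eA: "e \<in> A"
          using B e by auto
        have tb: "top_in {p, q, e} p Q \<longleftrightarrow> prec Q p q \<and> prec Q p e"
          "top_in {p, q, e} q Q \<longleftrightarrow> prec Q q p \<and> prec Q q e"
          "top_in {p, q, e} e Q \<longleftrightarrow> prec Q e p \<and> prec Q e q"
          "bot_in {p, q, e} p Q \<longleftrightarrow> prec Q q p \<and> prec Q e p"
          "bot_in {p, q, e} q Q \<longleftrightarrow> prec Q p q \<and> prec Q e q"
          "bot_in {p, q, e} e Q \<longleftrightarrow> prec Q p e \<and> prec Q q e" for Q
          using pq(3) e by (auto simp: top_in_def bot_in_def)
        have S_e: "prec ?S p e \<longleftrightarrow> prec R p e" "prec ?S q e \<longleftrightarrow> prec R q e"
          "prec ?S e p \<longleftrightarrow> prec R e p" "prec ?S e q \<longleftrightarrow> prec R e q"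
          using S_prec e pq(3) by auto
        \<comment> \<open>\<open>p\<close> and \<open>q\<close> are neighbours in \<open>R\<close>,
          so \<open>e\<close> lies above both or below both.\<close>
        have adj: "prec R p e \<longleftrightarrow> prec R q e"
          using lin[OF R] e eA s(1) by (auto simp: prec_append linear_orders_iff dest: prec_in_set)
        have fl: "prec Q e p \<longleftrightarrow> \<not> prec Q p e" "prec Q e q \<longleftrightarrow> \<not> prec Q q e"
          "prec Q q p \<longleftrightarrow> \<not> prec Q p q" if "Q \<in> D" for Q
          using flip that eA pq e(2,3) by metis+
        note flR = fl[OF R] and flT = fl[OF less.prems(1)]
        have dT: "distinct T"
          using lin[OF less.prems(1)] by (simp add: linear_orders_iff)
        have tr: "prec T e q \<Longrightarrow> prec T e p" "prec T p e \<Longrightarrow> prec T q e"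
          using prec_trans[OF dT] s(2) by blast+
        show ?thesis
        proof (cases "(prec R q e \<longleftrightarrow> prec T e q) \<and> (prec R p e \<longleftrightarrow> prec T e p)")
          case True
          text \<open>\<open>T\<close> reverses the triple, so \<open>R\<close> and \<open>T\<close> are the only orders that \<open>D\<close> induces on it.\<close>
          have two: "prec Q q p \<longleftrightarrow> prec Q v u" if Q: "Q \<in> D" and uv: "prec R u v" "prec T v u" for Q u v
          proof -
            have "(p, q) \<in> Dis R T" "(u, v) \<in> Dis R T"
              using uv s(2) pq(4) by (simp_all add: Dis_def)
            then have "(p, q) \<in> Dis R Q \<longleftrightarrow> (u, v) \<in> Dis R Q"
              using dich[OF Q] by blast
            then show ?thesis
              using uv(1) pq(4) by (simp add: Dis_def)
          qed
          show ?thesis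
          \<comment> \<open>If \<open>e\<close> is below, \<open>R\<close>, \<open>T\<close> and
            \<open>?S\<close> induce \<open>p q e\<close>, \<open>e q p\<close> and
            \<open>q p e\<close>, so \<open>q\<close> is never bottom. If \<open>e\<close> is above,
            they induce \<open>e p q\<close>, \<open>q p e\<close> and \<open>e q p\<close>, so
            \<open>p\<close> is never top.\<close>
          proof (cases "prec R q e")
            case R_qe: True
            have "\<not> bot_in {p, q, e} q Q" if "Q \<in> D" for Q
              using two[OF that R_qe] True R_qe fl(3)[OF that] unfolding tb by blast
            moreover have "\<not> bot_in {p, q, e} q ?S"
              using S_qp unfolding tb by blast
            ultimately show ?thesis
              unfolding e peak_pit_on_def by blast
          next
            case False
            then have "prec R e p" "prec T p e"
              using adj flR(1) flT(1) True by blast+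
            then have "\<not> top_in {p, q, e} p Q" if "Q \<in> D" for Q
              using two[OF that, of e p] fl(3)[OF that] unfolding tb by blast
            moreover have "\<not> top_in {p, q, e} p ?S"
              using S_qp unfolding tb by blast
            ultimately show ?thesis
              unfolding e peak_pit_on_def by blast
          qed
        next
          case not_rev: False
          \<comment> \<open>If \<open>e\<close> is below in \<open>R\<close>, \<open>?S\<close>
            induces \<open>q p e\<close>, with top \<open>q\<close> as in \<open>T\<close> and
            bottom \<open>e\<close> as in \<open>R\<close>. If \<open>e\<close> is above, it induces
            \<open>e q p\<close>, with top \<open>e\<close> as in \<open>R\<close> and bottom
            \<open>p\<close> as in \<open>T\<close>.\<close>
          show ?thesis
            unfolding e
          proof (rule peak_pit_on_insert[OF ppB[unfolded e]])
            fix x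
            assume x: "x \<in> {p, q, e}"
            show "\<exists>Q\<in>D. top_in {p, q, e} x Q" if x_top: "top_in {p, q, e} x ?S"
            proof (cases "prec R q e")
              case True
              then have "x = q"
                using x x_top S_qp(2) S_e(3) flR(1) adj tb by blast
              moreover have "prec T q e"
                using True not_rev adj tr(1) flT(2) by blast
              ultimately show ?thesis
                using s(2) less.prems(1) tb(2) by blast
            next
              case False
              then have "x = e"
                using x x_top S_qp(2) S_e(2) tb by blast
              then show ?thesis
                using False R flR(1,2) adj tb(3) by blast
            qed
            show "\<exists>Q\<in>D. bot_in {p, q, e} x Q" if x_bot: "bot_in {p, q, e} x ?S"
            proof (cases "prec R q e")
              case True
              then have "x = e"
                using x x_bot S_qp(2) S_e(3) flR(1) adj tb by blast
              then show ?thesis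
                using True R adj tb(6) by blast
            next
              case False
              then have "x = p"
                using x x_bot S_qp(2) S_e(1) adj tb by blast
              moreover have "prec T e p"
                using False not_rev adj tr(2) flT(1,2) by blast
              ultimately show ?thesis
                using s(2) less.prems(1) tb(4) by blast
            qed
          qed
        qed
      qed
    qed
    then show ?thesis
      using s by blast
  qed
qed

section \<open>Geodesics\<close>

lemma card_Dis_alike_le:
  assumes "alike R S" "distinct R"
  shows "card (Dis R T) \<le> Suc (card (Dis S T))"
proof -
  obtain p q where "\<And>x y. (x, y) \<noteq> (p, q) \<Longrightarrow> prec R x y \<Longrightarrow> prec S x y"
    using alike_prec[OF assms] by metis
  then have "card (Dis R T) \<le> card (insert (p, q) (Dis S T))"
    by (intro card_mono) (auto simp: finite_Dis, auto simp: Dis_def)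
  also have "\<dots> \<le> Suc (card (Dis S T))"
    by (simp add: card_insert_if finite_Dis)
  finally show ?thesis .
qed

text \<open>Each step removes at most one inversion, and none remain at \<open>T\<close>.
  \<open>Suc\<close> appears because a path's length counts orders, not steps.\<close>

lemma alike_path_length:
  "alike_path A R T p \<Longrightarrow> Suc (card (Dis R T)) \<le> length p"
proof (induction p arbitrary: R)
  case Nil
  then show ?case by (simp add: alike_path_def)
next
  case (Cons S p)
  then have R: "S = R" "distinct R"
    by (auto simp: alike_path_def linear_orders_iff)
  show ?case
  proof (cases p)
    case Nil
    then show ?thesis
      using Cons.prems Dis_self[OF R(2)] R by (simp add: alike_path_def)
  next
    case (Cons S' p')
    then have "alike_path A S' T p" "alike R S'"
      using Cons.prems R by (auto simp: alike_path_def)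
    then show ?thesis
      using Cons.IH card_Dis_alike_le[of R S' T] R by fastforce
  qed
qed

lemma ex_path_of_length:
  assumes fin: "finite A" and mx: "maximal_condorcet_domain A D" and pp: "peak_pit_domain A D"
    and T: "T \<in> D"
  shows "R \<in> D \<Longrightarrow> \<exists>p. alike_path A R T p \<and> set p \<subseteq> D \<and> length p = Suc (card (Dis R T))"
proof (induction "card (Dis R T)" arbitrary: R rule: less_induct)
  case less
  have lin: "S \<in> linear_orders A" if "S \<in> D" for S
    using that pp by (auto simp: peak_pit_domain_iff)
  have dR: "distinct R" and dT: "distinct T"
    using lin less.prems T by (auto simp: linear_orders_iff)
  show ?case
  proof (cases "R = T")
    case True
    then show ?thesis
      using less.prems lin dR by (intro exI[of _ "[R]"]) (auto simp: alike_path_def Dis_self)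
  next
    case False
    then obtain us p q vs where s: "R = us @ [p, q] @ vs" "us @ [q, p] @ vs \<in> D" "prec T q p"
      using ex_step[OF fin mx pp less.prems T] by blast
    let ?S = "us @ [q, p] @ vs"
    have pq: "p \<noteq> q" "\<not> prec ?S p q" "prec R p q" "\<not> prec T p q"
      using dR s prec_asym[OF dT s(3)] by (auto simp: prec_append dest: prec_in_set)
    have S_prec: "prec ?S x y \<longleftrightarrow> prec R x y" if "(x, y) \<noteq> (p, q)" "(x, y) \<noteq> (q, p)" for x y
      using that unfolding s(1) by (auto simp: prec_append)
    \<comment> \<open>The swap removes exactly the inversion \<open>(p, q)\<close>, so the path
      spends one step per inversion.\<close>
    have "(x, y) \<in> Dis R T \<longleftrightarrow> (x, y) \<in> insert (p, q) (Dis ?S T)" for x y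
    proof (cases "(x, y) = (p, q) \<or> (x, y) = (q, p)")
      case True
      then show ?thesis
        using pq s(3) by (auto simp: Dis_def)
    next
      case False
      then show ?thesis
        using S_prec[of x y] by (auto simp: Dis_def)
    qed
    then have Dis: "Dis R T = insert (p, q) (Dis ?S T)"
      by auto
    have "(p, q) \<notin> Dis ?S T"
      using pq by (simp add: Dis_def)
    then have card: "card (Dis R T) = Suc (card (Dis ?S T))"
      using Dis by (simp add: finite_Dis)
    then obtain w where w: "alike_path A ?S T w" "set w \<subseteq> D" "length w = Suc (card (Dis ?S T))"
      using less.hyps[of ?S] s(2) by auto
    have "alike R ?S"
      using s(1) \<open>p \<noteq> q\<close> unfolding alike_def by blast
    then have "alike_path A R T (R # w)"
      using w(1) lin[OF less.prems] by (cases w) (auto simp: alike_path_def)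
    then show ?thesis
      using w card less.prems by (intro exI[of _ "R # w"]) auto
  qed
qed

text \<open>The path inside \<open>D\<close> attains the lower bound valid for all paths, hence is a
  geodesic.\<close>

lemma peak_pit_imp_directly_connected:
  assumes "finite A" "maximal_condorcet_domain A D" "peak_pit_domain A D"
  shows "directly_connected_domain A D"
  unfolding directly_connected_domain_def geodesic_def
proof (intro ballI)
  fix R T
  assume "R \<in> D" "T \<in> D"
  then obtain p where "alike_path A R T p" "set p \<subseteq> D" "length p = Suc (card (Dis R T))"
    using ex_path_of_length[OF assms] by blast
  then show "\<exists>p. (alike_path A R T p \<and> (\<forall>q. alike_path A R T q \<longrightarrow> length p \<le> length q)) \<and> set p \<subseteq> D"
    using alike_path_length[of A R T] by auto
qed

theorem theorem3:
  fixes A :: "'a set" and D :: "'a list set"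
  assumes "finite A"
    and "maximal_condorcet_domain A D"
  shows "(peak_pit_domain A D \<longleftrightarrow> directly_connected_domain A D) \<and>
         (directly_connected_domain A D \<longleftrightarrow> connected_domain A D)"
proof -
  \<comment> \<open>A geodesic is in particular a path; the three implications then close a
    cycle.\<close>
  have "directly_connected_domain A D \<Longrightarrow> connected_domain A D"
    unfolding directly_connected_domain_def connected_domain_def geodesic_def by blast
  moreover have "connected_domain A D \<Longrightarrow> peak_pit_domain A D"
    using connected_imp_peak_pit assms(2) by (auto simp: maximal_condorcet_domain_def)
  ultimately show ?thesis
    using peak_pit_imp_directly_connected[OF assms] by blast
qed

end
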